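(* The system $$\dot x_1=x_3-x_2,\qquad \dot x_2=x_1-x_3,\qquad \dot x_3=x_2-x_1$$ can be written in the Lax form $\dot L=[N,L]$, where $$L=\begin{pmatrix}0&-x_3&x_2\\ x_3&0&-x_1\\ -x_2&x_1&0\end{pmatrix},\qquad N=\begin{pmatrix}0&-1-x_3&1+x_2\\ 1+x_3&0&-1-x_1\\ -1-x_2&1+x_1&0\end{pmatrix}.$$
   Context: Here $[N,L]=NL-LN$, and "can be written in the Lax form" means that the matrix equation $\dot L=[N,L]$ is equivalent to the given system. *)

theory Defs
  imports "HOL-Analysis.Analysis"
begin

definition commutator :: "real^'n^'n \<Rightarrow> real^'n^'n \<Rightarrow> real^'n^'n" where
  "commutator N L = N ** L - L ** N"

(* The inner lists are the rows: the entry in row i, column j is  M $ i $ j. *)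

definition Lmat :: "real \<Rightarrow> real \<Rightarrow> real \<Rightarrow> real^3^3" where
  "Lmat x1 x2 x3 = vector
     [vector [  0, -x3,  x2],
      vector [ x3,   0, -x1],
      vector [-x2,  x1,   0]]"

definition Nmat :: "real \<Rightarrow> real \<Rightarrow> real \<Rightarrow> real^3^3" where
  "Nmat x1 x2 x3 = vector
     [vector [      0, -1 - x3,  1 + x2],
      vector [ 1 + x3,       0, -1 - x1],
      vector [-1 - x2,  1 + x1,       0]]"

end

theory Submission imports Defs begin

text \<open>
  The matrix \<open>Lmat a1 a2 a3\<close> represents the map \<open>v \<mapsto> a \<times> v\<close>, and under this linear identification of
  \<open>\<real>\<^sup>3\<close> with the skew-symmetric matrices the commutator becomes the cross product
  (\<open>commutator_Lmat\<close>).  Since \<open>N = A + L\<close>, where \<open>A\<close> represents the constant vector \<open>(1, 1, 1)\<close>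
  (\<open>Nmat_eq\<close>), and \<open>L\<close> commutes with itself, the right-hand side of the Lax equation is \<open>[A, L]\<close>,
  the matrix of \<open>(1, 1, 1) \<times> (x1, x2, x3) = (x3 - x2, x1 - x3, x2 - x1)\<close> (\<open>commutator_Nmat_Lmat\<close>).
  This vector is the right-hand side of the system.  It remains to compare derivatives entry by
  entry: every entry of \<open>L\<close> is \<open>0\<close> or plus or minus a coordinate, and each coordinate
  occurs as an entry, so \<open>L\<close> has a given derivative exactly if the three coordinates do
  (\<open>has_vector_derivative_Lmat_iff\<close>).
\<close>

lemma has_vector_derivative_vec_iff:
  fixes f :: "real \<Rightarrow> ('a::real_normed_vector)^'n"
  shows "(f has_vector_derivative D) (at t within T) \<longleftrightarrow>
    (\<forall>i. ((\<lambda>s. f s $ i) has_vector_derivative D $ i) (at t within T))"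
proof
  assume "(f has_vector_derivative D) (at t within T)"
  then show "\<forall>i. ((\<lambda>s. f s $ i) has_vector_derivative D $ i) (at t within T)"
    using bounded_linear.has_vector_derivative[OF bounded_linear_vec_nth] by blast
next
  assume "\<forall>i. ((\<lambda>s. f s $ i) has_vector_derivative D $ i) (at t within T)"
  then show "(f has_vector_derivative D) (at t within T)"
    unfolding has_vector_derivative_def has_derivative_within
    by (auto intro: vec_tendstoI bounded_linear_scaleR_left)
qed

lemma has_vector_derivative_Lmat_iff:
  "((\<lambda>s. Lmat (x1 s) (x2 s) (x3 s)) has_vector_derivative Lmat d1 d2 d3) (at t within T) \<longleftrightarrow>
    (x1 has_real_derivative d1) (at t within T) \<and>
    (x2 has_real_derivative d2) (at t within T) \<and>
    (x3 has_real_derivative d3) (at t within T)"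
  by (auto simp: has_vector_derivative_vec_iff forall_3 Lmat_def
      has_real_derivative_iff_has_vector_derivative[symmetric]
      intro!: derivative_eq_intros)

text \<open>This is the isomorphism of Lie algebras between \<open>\<real>\<^sup>3\<close> with the cross product and \<open>so(3)\<close>.\<close>

lemma commutator_Lmat:
  "commutator (Lmat a1 a2 a3) (Lmat b1 b2 b3) =
    Lmat (a2 * b3 - a3 * b2) (a3 * b1 - a1 * b3) (a1 * b2 - a2 * b1)"
  by (simp add: commutator_def Lmat_def matrix_matrix_mult_def vec_eq_iff forall_3 sum_3
      algebra_simps)

lemma Nmat_eq: "Nmat x1 x2 x3 = Lmat 1 1 1 + Lmat x1 x2 x3"
  by (simp add: Nmat_def Lmat_def vec_eq_iff forall_3)

lemma commutator_add_self: "commutator (A + L) L = commutator A L"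
  by (simp add: commutator_def matrix_matrix_mult_def vec_eq_iff distrib_left distrib_right
      sum.distrib)

lemma commutator_Nmat_Lmat:
  "commutator (Nmat x1 x2 x3) (Lmat x1 x2 x3) = Lmat (x3 - x2) (x1 - x3) (x2 - x1)"
  by (simp add: Nmat_eq commutator_add_self commutator_Lmat)

theorem proposition4:
  fixes x1 x2 x3 :: "real \<Rightarrow> real" and T :: "real set"
  assumes "is_interval T"
  shows "(\<forall>t\<in>T. (x1 has_real_derivative x3 t - x2 t) (at t within T) \<and>
                (x2 has_real_derivative x1 t - x3 t) (at t within T) \<and>
                (x3 has_real_derivative x2 t - x1 t) (at t within T))
     \<longleftrightarrow> (\<forall>t\<in>T. ((\<lambda>s. Lmat (x1 s) (x2 s) (x3 s)) has_vector_derivative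
                  commutator (Nmat (x1 t) (x2 t) (x3 t)) (Lmat (x1 t) (x2 t) (x3 t)))
                (at t within T))"
  by (simp add: commutator_Nmat_Lmat has_vector_derivative_Lmat_iff)

end
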